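(* Consider a Markov decision process $(r,\Gamma,\beta,P)$ with state space $\mathsf X$ and action space $\mathsf A$ satisfying the standing assumptions described in the context, and let $\sigma\in\Sigma$. If $P_\sigma$ is open set irreducible and $\sigma$ is continuous (as a map $\mathsf X\to\mathsf A$), then the following three statements are equivalent: (E1) there exists $x\in\mathsf X$ such that $v_s(x)\le v_\sigma(x)$ for all $s\in\Sigma$; (E2) there exists a Borel probability measure $\rho$ on $\mathsf X$ such that $\int v_s\,\mathrm d\rho\le\int v_\sigma\,\mathrm d\rho$ for all $s\in\Sigma$; (E3) $\sigma$ is an optimal policy, i.e. $v_\sigma(x)=v^*(x)$ for all $x\in\mathsf X$.
   Context: $\mathsf X$ and $\mathsf A$ are metric spaces; $b\mathsf X$ is the space of bounded Borel measurable functions $\mathsf X\to\mathbb R$ (supremum norm, pointwise order), $cb\mathsf X$ the continuous ones. A Markov decision process is a tuple $(r,\Gamma,\beta,P)$ where: $\beta\in(0,1)$; $\Gamma$ is a nonempty, compact-valued, continuous correspondence from $\mathsf X$ to $\mathsf A$; with $\mathsf G=\{(x,a): a\in\Gamma(x)\}$, $r:\mathsf G\to\mathbb R$ is bounded and continuous; for each $(x,a)\in\mathsf G$, $P(x,a,\cdot)$ is a Borel probability measure on $\mathsf X$, and $(x,a)\mapsto\int v(x')P(x,a,\mathrm dx')$ is continuous on $\mathsf G$ for every $v\in cb\mathsf X$. $\Sigma$ is the set of Borel measurable $\sigma:\mathsf X\to\mathsf A$ with $\sigma(x)\in\Gamma(x)$ for all $x$. For $\sigma\in\Sigma$, $r_\sigma(x)=r(x,\sigma(x))$,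 $P_\sigma(x,\mathrm dx')=P(x,\sigma(x),\mathrm dx')$ with Markov operator $(P_\sigma f)(x)=\int f(x')P_\sigma(x,\mathrm dx')$, $P_\sigma^n$ the $n$-step kernel, and $v_\sigma=\sum_{t\ge0}(\beta P_\sigma)^t r_\sigma$. The value function is $v^*(x)=\sup_{s\in\Sigma}v_s(x)$; $\sigma$ is optimal if $v_\sigma=v^*$ on $\mathsf X$. For a transition kernel $Q$ on $\mathsf X$, $y$ is $Q$-reachable from $x$ if for every open neighborhood $G$ of $y$ there is $n\in\mathbb N=\{1,2,\dots\}$ with $Q^n(x,G)>0$; $Q$ is open set irreducible if every $y\in\mathsf X$ is $Q$-reachable from every $x\in\mathsf X$. *)

theory Defs
  imports "HOL-Probability.Probability"
begin

definition upper_hemicontinuous :: "('x::topological_space \<Rightarrow> 'a::topological_space set) \<Rightarrow> bool" where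
  "upper_hemicontinuous \<Gamma> \<longleftrightarrow>
     (\<forall>x V. open V \<and> \<Gamma> x \<subseteq> V \<longrightarrow> (\<exists>U. open U \<and> x \<in> U \<and> (\<forall>y\<in>U. \<Gamma> y \<subseteq> V)))"

definition lower_hemicontinuous :: "('x::topological_space \<Rightarrow> 'a::topological_space set) \<Rightarrow> bool" where
  "lower_hemicontinuous \<Gamma> \<longleftrightarrow>
     (\<forall>x V. open V \<and> \<Gamma> x \<inter> V \<noteq> {} \<longrightarrow> (\<exists>U. open U \<and> x \<in> U \<and> (\<forall>y\<in>U. \<Gamma> y \<inter> V \<noteq> {})))"

definition continuous_correspondence :: "('x::topological_space \<Rightarrow> 'a::topological_space set) \<Rightarrow> bool" where
  "continuous_correspondence \<Gamma> \<longleftrightarrow> upper_hemicontinuous \<Gamma> \<and> lower_hemicontinuous \<Gamma>"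

definition graphG :: "('x \<Rightarrow> 'a set) \<Rightarrow> ('x \<times> 'a) set" where
  "graphG \<Gamma> = {(x, a). a \<in> \<Gamma> x}"

definition is_mdp ::
  "('x::metric_space \<Rightarrow> 'a::metric_space \<Rightarrow> real) \<Rightarrow> ('x \<Rightarrow> 'a set) \<Rightarrow> real \<Rightarrow> ('x \<Rightarrow> 'a \<Rightarrow> 'x measure) \<Rightarrow> bool" where
  "is_mdp r \<Gamma> \<beta> P \<longleftrightarrow>
     0 < \<beta> \<and> \<beta> < 1 \<and>
     (\<forall>x. \<Gamma> x \<noteq> {} \<and> compact (\<Gamma> x)) \<and>
     continuous_correspondence \<Gamma> \<and>
     continuous_on (graphG \<Gamma>) (\<lambda>p. r (fst p) (snd p)) \<and>
     bounded ((\<lambda>p. r (fst p) (snd p)) ` graphG \<Gamma>) \<and>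
     (\<forall>x a. a \<in> \<Gamma> x \<longrightarrow> prob_space (P x a) \<and> sets (P x a) = sets borel) \<and>
     (\<forall>v::'x \<Rightarrow> real. continuous_on UNIV v \<and> bounded (range v) \<longrightarrow>
        continuous_on (graphG \<Gamma>) (\<lambda>p. \<integral>y. v y \<partial>(P (fst p) (snd p))))"

definition policies :: "('x::topological_space \<Rightarrow> 'a::topological_space set) \<Rightarrow> ('x \<Rightarrow> 'a) set" where
  "policies \<Gamma> = {\<sigma>. \<sigma> \<in> borel_measurable borel \<and> (\<forall>x. \<sigma> x \<in> \<Gamma> x)}"

definition Pop :: "('x \<Rightarrow> 'a \<Rightarrow> 'x measure) \<Rightarrow> ('x \<Rightarrow> 'a) \<Rightarrow> ('x \<Rightarrow> real) \<Rightarrow> 'x \<Rightarrow> real" where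
  "Pop P \<sigma> f x = (\<integral>y. f y \<partial>(P x (\<sigma> x)))"

definition kpow :: "('x \<Rightarrow> 'a \<Rightarrow> 'x measure) \<Rightarrow> ('x \<Rightarrow> 'a) \<Rightarrow> nat \<Rightarrow> 'x \<Rightarrow> 'x set \<Rightarrow> real" where
  "kpow P \<sigma> n x G = (Pop P \<sigma> ^^ n) (indicator G) x"

definition vpol :: "('x \<Rightarrow> 'a \<Rightarrow> real) \<Rightarrow> real \<Rightarrow> ('x \<Rightarrow> 'a \<Rightarrow> 'x measure) \<Rightarrow> ('x \<Rightarrow> 'a) \<Rightarrow> 'x \<Rightarrow> real" where
  "vpol r \<beta> P \<sigma> x = (\<Sum>t. \<beta> ^ t * (Pop P \<sigma> ^^ t) (\<lambda>y. r y (\<sigma> y)) x)"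

definition vstar :: "('x::topological_space \<Rightarrow> 'a::topological_space \<Rightarrow> real) \<Rightarrow> ('x \<Rightarrow> 'a set) \<Rightarrow> real \<Rightarrow> ('x \<Rightarrow> 'a \<Rightarrow> 'x measure) \<Rightarrow> 'x \<Rightarrow> real" where
  "vstar r \<Gamma> \<beta> P x = (SUP s\<in>policies \<Gamma>. vpol r \<beta> P s x)"

definition optimal_policy where
  "optimal_policy r \<Gamma> \<beta> P \<sigma> \<longleftrightarrow> (\<forall>x. vpol r \<beta> P \<sigma> x = vstar r \<Gamma> \<beta> P x)"

section \<open>Reachability for a kernel given by its n-step probabilities Qn n x G = Q^n(x,G)\<close>

definition reachable :: "(nat \<Rightarrow> 'x::topological_space \<Rightarrow> 'x set \<Rightarrow> real) \<Rightarrow> 'x \<Rightarrow> 'x \<Rightarrow> bool" where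
  "reachable Qn x y \<longleftrightarrow> (\<forall>G. open G \<and> y \<in> G \<longrightarrow> (\<exists>n\<ge>1. Qn n x G > 0))"

definition open_set_irreducible :: "(nat \<Rightarrow> 'x::topological_space \<Rightarrow> 'x set \<Rightarrow> real) \<Rightarrow> bool" where
  "open_set_irreducible Qn \<longleftrightarrow> (\<forall>x y. reachable Qn x y)"

end

theory Submission
  imports Defs
begin

text \<open>The substantial step is that a continuous policy \<open>\<sigma>\<close> with an open set irreducible kernel is
  either optimal or strictly worse than some other policy at every state; the latter contradicts
  any of the three statements. If \<open>\<sigma>\<close> is not optimal, its advantage function is positive at some
  feasible pair. It is continuous on the graph of \<open>\<Gamma>\<close>, so lower hemicontinuity and a measurable
  selection give a policy \<open>s\<close> that equals \<open>\<sigma>\<close> off an open set \<open>U\<close> and has positive advantage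
  on \<open>U\<close>. As every state reaches \<open>U\<close> under \<open>\<sigma>\<close>, this yields \<open>v\<^sub>s > v\<^sub>\<sigma>\<close> everywhere.

  The spaces are not assumed separable, which endangers the measurability of \<open>x \<mapsto> P(x, s(x), \<cdot>)\<close>
  for a merely measurable \<open>s\<close>. But irreducibility gives every nonempty open set positive mass under
  some \<open>n\<close>-step kernel from a fixed state, so disjoint families of open sets are countable and the
  state space is separable.\<close>

section \<open>Countable dense sets and bases\<close>

lemma maximal_pairwise_set:
  obtains S where "pairwise R S" and "\<And>x. pairwise R (insert x S) \<Longrightarrow> x \<in> S"
proof -
  have "\<exists>S\<in>Collect (pairwise R). \<forall>T\<in>Collect (pairwise R). S \<subseteq> T \<longrightarrow> T = S"
    by (rule subset_Zorn') (auto simp: subset_chain_def chain_subset_def intro!: pairwise_chain_Union)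
  then show thesis
    using that by blast
qed

lemma maximal_separated_set:
  assumes "0 < \<epsilon>"
  obtains S :: "'x::metric_space set"
  where "pairwise (\<lambda>x y. \<epsilon> \<le> dist x y) S" and "\<And>x. \<exists>y\<in>S. dist y x < \<epsilon>"
proof (rule maximal_pairwise_set[where R = "\<lambda>x y. \<epsilon> \<le> dist x y"])
  fix S :: "'x set"
  assume separated: "pairwise (\<lambda>x y. \<epsilon> \<le> dist x y) S"
    and maximal: "\<And>x. pairwise (\<lambda>x y. \<epsilon> \<le> dist x y) (insert x S) \<Longrightarrow> x \<in> S"
  have "\<exists>y\<in>S. dist y x < \<epsilon>" for x
  proof (rule ccontr)
    assume far: "\<not> (\<exists>y\<in>S. dist y x < \<epsilon>)"
    then have "pairwise (\<lambda>x y. \<epsilon> \<le> dist x y) (insert x S)"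
      using separated by (auto simp: pairwise_insert dist_commute not_less)
    then have "x \<in> S"
      by (rule maximal)
    with far \<open>0 < \<epsilon>\<close> show False
      by auto
  qed
  with separated show thesis
    by (rule that)
qed

lemma countable_separated_set:
  fixes S :: "'x::metric_space set"
  assumes ccc: "\<And>\<U> :: 'x set set. (\<And>U. U \<in> \<U> \<Longrightarrow> open U) \<Longrightarrow> pairwise disjnt \<U> \<Longrightarrow> countable \<U>"
    and "0 < \<epsilon>" and separated: "pairwise (\<lambda>x y. \<epsilon> \<le> dist x y) S"
  shows "countable S"
proof -
  have disjoint: "disjnt (ball x (\<epsilon> / 2)) (ball y (\<epsilon> / 2))" if "x \<in> S" "y \<in> S" "x \<noteq> y" for x y
    using separated that by (simp add: disjnt_def pairwise_def disjoint_ballI)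
  have "countable ((\<lambda>x. ball x (\<epsilon> / 2)) ` S)"
    using disjoint by (intro ccc pairwise_imageI) auto
  moreover have "inj_on (\<lambda>x. ball x (\<epsilon> / 2)) S"
  proof (rule inj_onI)
    fix x y assume "x \<in> S" "y \<in> S" "ball x (\<epsilon> / 2) = ball y (\<epsilon> / 2)"
    moreover have "x \<in> ball x (\<epsilon> / 2)"
      using \<open>0 < \<epsilon>\<close> by simp
    ultimately show "x = y"
      using disjoint[of x y] unfolding disjnt_iff by metis
  qed
  ultimately show ?thesis
    by (simp add: countable_image_inj_eq)
qed

lemma countable_disjoint_open_imp_countable_dense:
  assumes ccc: "\<And>\<U> :: 'x::metric_space set set.
      (\<And>U. U \<in> \<U> \<Longrightarrow> open U) \<Longrightarrow> pairwise disjnt \<U> \<Longrightarrow> countable \<U>"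
  obtains D :: "'x::metric_space set" where "countable D" and "closure D = UNIV"
proof -
  define \<epsilon> where "\<epsilon> n = 1 / real (Suc n)" for n
  have \<epsilon>_pos: "0 < \<epsilon> n" for n
    by (simp add: \<epsilon>_def)
  have "\<exists>S :: 'x set. pairwise (\<lambda>x y. \<epsilon> n \<le> dist x y) S \<and> (\<forall>x. \<exists>y\<in>S. dist y x < \<epsilon> n)" for n
    using maximal_separated_set[OF \<epsilon>_pos] by metis
  then obtain S :: "nat \<Rightarrow> 'x set" where separated: "\<And>n. pairwise (\<lambda>x y. \<epsilon> n \<le> dist x y) (S n)"
    and near: "\<And>n x. \<exists>y\<in>S n. dist y x < \<epsilon> n"
    by metis
  have "x \<in> closure (\<Union>n. S n)" for x
    unfolding closure_approachable
  proof (intro allI impI)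
    fix e :: real assume "0 < e"
    then obtain n where "\<epsilon> n < e"
      using nat_approx_posE unfolding \<epsilon>_def by blast
    with near[of n x] show "\<exists>y\<in>\<Union>n. S n. dist y x < e"
      by force
  qed
  moreover have "countable (\<Union>n. S n)"
    using countable_separated_set[OF ccc \<epsilon>_pos separated] by simp
  ultimately show thesis
    by (intro that) auto
qed

lemma countable_dense_imp_countable_basis:
  fixes D :: "'x::metric_space set"
  assumes "countable D" and "closure D = UNIV"
  obtains \<B> :: "'x set set" where "countable \<B>" and "topological_basis \<B>"
proof
  let ?\<B> = "(\<lambda>(d, n). ball d (1 / real (Suc n))) ` (D \<times> UNIV)"
  show "countable ?\<B>"
    using assms(1) by simp
  show "topological_basis ?\<B>"
  proof (rule topological_basisI)
    fix U and x :: 'x assume "open U" "x \<in> U"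
    then obtain e where e: "0 < e" "ball x e \<subseteq> U"
      by (auto simp: open_contains_ball)
    obtain n where n: "1 / real (Suc n) < e / 2"
      using nat_approx_posE[of "e / 2"] e by auto
    have "x \<in> closure D"
      using assms(2) by simp
    then obtain d where d: "d \<in> D" "dist d x < 1 / real (Suc n)"
      unfolding closure_approachable by (metis of_nat_0_less_iff zero_less_Suc zero_less_divide_1_iff)
    have "ball d (1 / real (Suc n)) \<subseteq> ball x e"
    proof
      fix y assume "y \<in> ball d (1 / real (Suc n))"
      then show "y \<in> ball x e"
        using d(2) n dist_triangle[of x y d] by (simp add: dist_commute)
    qed
    with d e show "\<exists>B\<in>?\<B>. x \<in> B \<and> B \<subseteq> U"
      by (intro bexI[of _ "ball d (1 / real (Suc n))"]) auto
  qed auto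
qed

lemma borel_measurable_graph:
  fixes \<B> :: "'x::topological_space set set" and s :: "'x \<Rightarrow> 'a::topological_space"
  assumes "countable \<B>" and basis: "topological_basis \<B>" and s: "s \<in> borel_measurable borel"
  shows "(\<lambda>x. (x, s x)) \<in> borel_measurable borel"
proof (rule borel_measurableI)
  fix S :: "('x \<times> 'a) set" assume "open S"
  define V where "V B = \<Union>{V. open V \<and> B \<times> V \<subseteq> S}" for B
  have "\<exists>B\<in>\<B>. x \<in> B \<and> s x \<in> V B" if graph: "(x, s x) \<in> S" for x
  proof -
    obtain A V' where AV: "open A" "open V'" "(x, s x) \<in> A \<times> V'" "A \<times> V' \<subseteq> S"
      using open_prod_elim[OF \<open>open S\<close> graph] .
    then obtain B where B: "B \<in> \<B>" "x \<in> B" "B \<subseteq> A"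
      using topological_basisE[OF basis] by blast
    then have "B \<times> V' \<subseteq> S"
      using AV(4) by blast
    then have "s x \<in> V B"
      using AV(2,3) unfolding V_def by blast
    with B show ?thesis
      by blast
  qed
  moreover have "(x, s x) \<in> S" if "x \<in> B" "s x \<in> V B" for x B
    using that by (auto simp: V_def)
  ultimately have "(\<lambda>x. (x, s x)) -` S \<inter> space borel = (\<Union>B\<in>\<B>. B \<inter> (s -` V B \<inter> space borel))"
    by auto
  also have "\<dots> \<in> sets borel"
  proof (rule sets.countable_UN'[OF \<open>countable \<B>\<close>], rule image_subsetI)
    fix B assume "B \<in> \<B>"
    have "open (V B)"
      unfolding V_def by (rule open_Union) blast
    then have "s -` V B \<inter> space borel \<in> sets borel"
      using measurable_sets[OF s, of "V B"] by simp
    moreover have "open B"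
      using basis \<open>B \<in> \<B>\<close> by (rule topological_basis_open)
    ultimately show "B \<inter> (s -` V B \<inter> space borel) \<in> sets borel"
      by (blast intro: borel_open)
  qed
  finally show "(\<lambda>x. (x, s x)) -` S \<inter> space borel \<in> sets borel" .
qed

section \<open>Measurable selection\<close>

definition measurable_correspondence ::
  "'x measure \<Rightarrow> ('x \<Rightarrow> 'a::topological_space set) \<Rightarrow> bool" where
  "measurable_correspondence M F \<longleftrightarrow> (\<forall>C. closed C \<longrightarrow> {x \<in> space M. F x \<inter> C \<noteq> {}} \<in> sets M)"

lemma measurable_correspondence_singleton:
  fixes f :: "'x \<Rightarrow> 'a::topological_space"
  assumes "f \<in> borel_measurable M"
  shows "measurable_correspondence M (\<lambda>x. {f x})"
  unfolding measurable_correspondence_def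
proof (intro allI impI)
  fix C :: "'a set" assume "closed C"
  then have "f -` C \<inter> space M \<in> sets M"
    by (intro measurable_sets[OF assms] borel_closed)
  also have "f -` C \<inter> space M = {x \<in> space M. {f x} \<inter> C \<noteq> {}}"
    by auto
  finally show "{x \<in> space M. {f x} \<inter> C \<noteq> {}} \<in> sets M" .
qed

lemma measurable_correspondence_Int_closed:
  assumes "measurable_correspondence M F" and "closed K"
  shows "measurable_correspondence M (\<lambda>x. F x \<inter> K)"
  using assms by (simp add: measurable_correspondence_def Int_assoc closed_Int)

lemma measurable_correspondence_If:
  fixes F G :: "'x \<Rightarrow> 'a::topological_space set"
  assumes F: "measurable_correspondence M F" and G: "measurable_correspondence M G"
    and U: "U \<inter> space M \<in> sets M"
  shows "measurable_correspondence M (\<lambda>x. if x \<in> U then F x else G x)"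
  unfolding measurable_correspondence_def
proof (intro allI impI)
  fix C :: "'a set" assume "closed C"
  have "{x \<in> space M. (if x \<in> U then F x else G x) \<inter> C \<noteq> {}}
      = ({x \<in> space M. F x \<inter> C \<noteq> {}} \<inter> (U \<inter> space M))
        \<union> ({x \<in> space M. G x \<inter> C \<noteq> {}} - (U \<inter> space M))"
    by auto
  also have "\<dots> \<in> sets M"
    using F G \<open>closed C\<close>
    by (intro sets.Un sets.Int[OF _ U] sets.Diff[OF _ U]) (auto simp: measurable_correspondence_def)
  finally show "{x \<in> space M. (if x \<in> U then F x else G x) \<inter> C \<noteq> {}} \<in> sets M" .
qed

lemma upper_hemicontinuous_imp_measurable_correspondence:
  fixes \<Gamma> :: "'x::topological_space \<Rightarrow> 'a::topological_space set"
  assumes "upper_hemicontinuous \<Gamma>"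
  shows "measurable_correspondence borel \<Gamma>"
  unfolding measurable_correspondence_def
proof (intro allI impI)
  fix C :: "'a set" assume "closed C"
  have "open {x. \<Gamma> x \<subseteq> - C}"
  proof (subst open_subopen, intro ballI)
    fix x assume "x \<in> {x. \<Gamma> x \<subseteq> - C}"
    then obtain U where "open U" "x \<in> U" "\<And>y. y \<in> U \<Longrightarrow> \<Gamma> y \<subseteq> - C"
      using assms \<open>closed C\<close> unfolding upper_hemicontinuous_def by (metis CollectD open_Compl)
    then show "\<exists>U. open U \<and> x \<in> U \<and> U \<subseteq> {x. \<Gamma> x \<subseteq> - C}"
      by blast
  qed
  then have "closed (- {x. \<Gamma> x \<subseteq> - C})"
    by (simp add: closed_Compl)
  also have "- {x. \<Gamma> x \<subseteq> - C} = {x \<in> space borel. \<Gamma> x \<inter> C \<noteq> {}}"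
    by auto
  finally show "{x \<in> space borel. \<Gamma> x \<inter> C \<noteq> {}} \<in> sets borel"
    by (rule borel_closed)
qed

definition nearest_points :: "'a::metric_space \<Rightarrow> 'a set \<Rightarrow> 'a set" where
  "nearest_points a S = {y \<in> S. \<forall>z\<in>S. dist a y \<le> dist a z}"

lemma nearest_points_subset: "nearest_points a S \<subseteq> S"
  by (auto simp: nearest_points_def)

lemma nearest_points_nonempty:
  assumes "compact S" and "S \<noteq> {}"
  shows "nearest_points a S \<noteq> {}"
proof -
  have "\<exists>y\<in>S. \<forall>z\<in>S. dist a y \<le> dist a z"
    using assms by (intro continuous_attains_inf continuous_intros)
  then show ?thesis
    by (auto simp: nearest_points_def)
qed

lemma compact_nearest_points:
  assumes "compact S"
  shows "compact (nearest_points a S)"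
proof -
  have "nearest_points a S = S \<inter> (\<Inter>z\<in>S. cball a (dist a z))"
    by (auto simp: nearest_points_def)
  then show ?thesis
    using assms by (auto intro!: compact_Int_closed)
qed

lemma nearest_points_Int_closed_nonempty_iff:
  assumes "compact S" and "closed C"
  shows "nearest_points a S \<inter> C \<noteq> {} \<longleftrightarrow> S \<inter> C \<noteq> {} \<and>
    (\<forall>q::rat. S \<inter> cball a (of_rat q) \<noteq> {} \<longrightarrow> S \<inter> (C \<inter> cball a (of_rat q)) \<noteq> {})"
    (is "?nearest \<longleftrightarrow> ?approx")
proof
  assume ?nearest
  then obtain y where y: "y \<in> S" "y \<in> C" and min: "\<And>z. z \<in> S \<Longrightarrow> dist a y \<le> dist a z"
    by (auto simp: nearest_points_def)
  have "y \<in> S \<inter> (C \<inter> cball a (of_rat q))" if "S \<inter> cball a (of_rat q) \<noteq> {}" for q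
  proof -
    from that obtain z where "z \<in> S" "dist a z \<le> of_rat q"
      by auto
    with min[of z] y show ?thesis
      by auto
  qed
  with y show ?approx
    by blast
next
  assume approx: ?approx
  then have "nearest_points a (S \<inter> C) \<noteq> {}"
    using assms by (intro nearest_points_nonempty compact_Int_closed) auto
  then obtain y where y: "y \<in> S" "y \<in> C" and min: "\<And>z. z \<in> S \<Longrightarrow> z \<in> C \<Longrightarrow> dist a y \<le> dist a z"
    by (auto simp: nearest_points_def)
  have "dist a y \<le> dist a z" if "z \<in> S" for z
  proof (rule ccontr)
    assume "\<not> dist a y \<le> dist a z"
    then obtain q where q: "dist a z < of_rat q" "of_rat q < dist a y"
      using of_rat_dense[of "dist a z" "dist a y"] by auto
    then have "S \<inter> cball a (of_rat q) \<noteq> {}"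
      using \<open>z \<in> S\<close> by force
    then have "S \<inter> (C \<inter> cball a (of_rat q)) \<noteq> {}"
      using approx by blast
    then obtain u where "u \<in> S" "u \<in> C" "dist a u \<le> of_rat q"
      by auto
    with min[of u] q show False
      by linarith
  qed
  with y show ?nearest
    by (auto simp: nearest_points_def)
qed

lemma measurable_correspondence_nearest_points:
  fixes F :: "'x \<Rightarrow> 'a::metric_space set"
  assumes comp: "\<And>x. x \<in> space M \<Longrightarrow> compact (F x)" and F: "measurable_correspondence M F"
  shows "measurable_correspondence M (\<lambda>x. nearest_points a (F x))"
  unfolding measurable_correspondence_def
proof (intro allI impI)
  fix C :: "'a set" assume C: "closed C"
  have "{x \<in> space M. F x \<inter> C \<noteq> {} \<and>
      (\<forall>q::rat. F x \<inter> cball a (of_rat q) \<noteq> {} \<longrightarrow> F x \<inter> (C \<inter> cball a (of_rat q)) \<noteq> {})} \<in> sets M"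
    by (intro sets.sets_Collect_conj sets.sets_Collect_countable_All sets.sets_Collect_imp
        F[unfolded measurable_correspondence_def, rule_format] closed_Int closed_cball C)
  then show "{x \<in> space M. nearest_points a (F x) \<inter> C \<noteq> {}} \<in> sets M"
    using nearest_points_Int_closed_nonempty_iff[OF comp C] by (simp cong: conj_cong)
qed

lemma compact_decseq_INT_nonempty:
  fixes F :: "nat \<Rightarrow> 'a::t2_space set"
  assumes "\<And>n. compact (F n)" and "\<And>n. F n \<noteq> {}" and "decseq F"
  shows "(\<Inter>n. F n) \<noteq> {}"
proof -
  have "F 0 \<inter> (\<Inter>n\<in>UNIV. F n) \<noteq> {}"
  proof (rule compact_imp_fip_image)
    fix I :: "nat set" assume "finite I"
    then have "F (Max (insert 0 I)) \<subseteq> F 0 \<inter> (\<Inter>n\<in>I. F n)"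
      by (intro Int_greatest INF_greatest decseqD[OF \<open>decseq F\<close>]) auto
    then show "F 0 \<inter> (\<Inter>n\<in>I. F n) \<noteq> {}"
      using assms(2) by blast
  qed (use assms in \<open>auto intro: compact_imp_closed\<close>)
  then show ?thesis
    by blast
qed

text \<open>Minimising the distances to a dense sequence one after the other shrinks a compact set to a
  single point, and every stage of this process stays measurable.\<close>

primrec nearest_chain :: "(nat \<Rightarrow> 'a::metric_space) \<Rightarrow> 'a set \<Rightarrow> nat \<Rightarrow> 'a set" where
  "nearest_chain a S 0 = S"
| "nearest_chain a S (Suc n) = nearest_points (a n) (nearest_chain a S n)"

lemma decseq_nearest_chain: "decseq (nearest_chain a S)"
  by (rule decseq_SucI) (simp add: nearest_points_subset)

lemma compact_nearest_chain: "compact S \<Longrightarrow> compact (nearest_chain a S n)"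
  by (induction n) (auto intro: compact_nearest_points)

lemma nearest_chain_nonempty:
  assumes "compact S" and "S \<noteq> {}"
  shows "nearest_chain a S n \<noteq> {}"
  using assms by (induction n) (auto simp: nearest_points_nonempty compact_nearest_chain)

lemma measurable_correspondence_nearest_chain:
  assumes "\<And>x. x \<in> space M \<Longrightarrow> compact (F x)" and "measurable_correspondence M F"
  shows "measurable_correspondence M (\<lambda>x. nearest_chain a (F x) n)"
  using assms by (induction n) (simp_all add: measurable_correspondence_nearest_points compact_nearest_chain)

lemma nearest_chain_INT_unique:
  assumes "S \<subseteq> closure (range a)"
    and y: "\<And>n. y \<in> nearest_chain a S n" and z: "\<And>n. z \<in> nearest_chain a S n"
  shows "y = z"
proof (rule ccontr)
  assume "y \<noteq> z"
  moreover have "y \<in> closure (range a)"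
    using y[of 0] assms(1) by auto
  ultimately obtain n where n: "dist (a n) y < dist y z / 2"
    unfolding closure_approachable by (metis half_gt_zero rangeE zero_less_dist_iff)
  have "dist (a n) y = dist (a n) z"
    using y[of "Suc n"] z[of "Suc n"] y[of n] z[of n] by (force simp: nearest_points_def)
  with n dist_triangle2[of y z "a n"] show False
    by (simp add: dist_commute)
qed

definition nearest_limit :: "(nat \<Rightarrow> 'a::metric_space) \<Rightarrow> 'a set \<Rightarrow> 'a" where
  "nearest_limit a S = (SOME y. \<forall>n. y \<in> nearest_chain a S n)"

lemma nearest_limit_in_chain:
  assumes "compact S" and "S \<noteq> {}"
  shows "nearest_limit a S \<in> nearest_chain a S n"
proof -
  have "(\<Inter>n. nearest_chain a S n) \<noteq> {}"
    using assms
    by (intro compact_decseq_INT_nonempty compact_nearest_chain nearest_chain_nonempty decseq_nearest_chain)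
  then have "\<exists>y. \<forall>n. y \<in> nearest_chain a S n"
    by blast
  from someI_ex[OF this] show ?thesis
    by (simp add: nearest_limit_def)
qed

lemma nearest_limit_in_closed_iff:
  assumes S: "compact S" "S \<noteq> {}" "S \<subseteq> closure (range a)" and C: "closed C"
  shows "nearest_limit a S \<in> C \<longleftrightarrow> (\<forall>n. nearest_chain a S n \<inter> C \<noteq> {})"
proof
  assume hit: "\<forall>n. nearest_chain a S n \<inter> C \<noteq> {}"
  have "(\<Inter>n. nearest_chain a S n \<inter> C) \<noteq> {}"
  proof (rule compact_decseq_INT_nonempty)
    show "compact (nearest_chain a S n \<inter> C)" for n
      using S(1) C by (intro compact_Int_closed compact_nearest_chain)
    show "decseq (\<lambda>n. nearest_chain a S n \<inter> C)"
      using decseq_nearest_chain[of a S] by (auto simp: decseq_def)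
  qed (use hit in auto)
  then obtain y where "\<And>n. y \<in> nearest_chain a S n" "y \<in> C"
    by auto
  with nearest_chain_INT_unique[OF S(3)] nearest_limit_in_chain[OF S(1,2)]
  show "nearest_limit a S \<in> C"
    by metis
qed (use nearest_limit_in_chain[OF S(1,2)] in auto)

lemma compact_valued_measurable_selection:
  fixes F :: "'x \<Rightarrow> 'a::metric_space set"
  assumes F: "measurable_correspondence M F"
    and comp: "\<And>x. x \<in> space M \<Longrightarrow> compact (F x)" and ne: "\<And>x. x \<in> space M \<Longrightarrow> F x \<noteq> {}"
    and "countable D" and dense: "\<And>x. x \<in> space M \<Longrightarrow> F x \<subseteq> closure D"
  obtains s where "s \<in> borel_measurable M" and "\<And>x. x \<in> space M \<Longrightarrow> s x \<in> F x"
proof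
  define a where "a = from_nat_into (insert undefined D)"
  have "D \<subseteq> range a"
    using \<open>countable D\<close> by (auto simp: a_def range_from_nat_into)
  then have dense_a: "F x \<subseteq> closure (range a)" if "x \<in> space M" for x
    using dense[OF that] closure_mono by blast
  let ?s = "\<lambda>x. nearest_limit a (F x)"
  show "?s x \<in> F x" if "x \<in> space M" for x
    using nearest_limit_in_chain[OF comp ne, OF that that, of a 0] by simp
  have "{x \<in> space M. ?s x \<in> C} \<in> sets M" if "closed C" for C
  proof -
    have "{x \<in> space M. \<forall>n. nearest_chain a (F x) n \<inter> C \<noteq> {}} \<in> sets M"
      using measurable_correspondence_nearest_chain[OF comp F] \<open>closed C\<close>
      by (intro sets.sets_Collect_countable_All) (auto simp: measurable_correspondence_def)
    then show ?thesis
      using nearest_limit_in_closed_iff[OF comp ne dense_a \<open>closed C\<close>] by (simp cong: conj_cong)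
  qed
  then show "?s \<in> borel_measurable M"
    unfolding borel_eq_closed
    by (intro measurable_measure_of) (auto simp: vimage_def Int_def conj_commute)
qed

lemma lower_hemicontinuous_separable_range:
  fixes \<Gamma> :: "'x::topological_space \<Rightarrow> 'a::metric_space set"
  assumes lhc: "lower_hemicontinuous \<Gamma>" and comp: "\<And>x. compact (\<Gamma> x)"
    and "countable (D :: 'x set)" and dense: "closure D = UNIV"
  obtains E where "countable E" and "\<And>x. \<Gamma> x \<subseteq> closure E"
proof -
  have "\<exists>k. finite k \<and> \<Gamma> d \<subseteq> (\<Union>z\<in>k. ball z (1 / real (Suc n)))" for d n
    by (rule compactE_image[OF comp[of d], of "\<Gamma> d" "\<lambda>z. ball z (1 / real (Suc n))"]) auto
  then obtain k where finite_k: "\<And>d n. finite (k d n)"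
    and cover: "\<And>d n. \<Gamma> d \<subseteq> (\<Union>z\<in>k d n. ball z (1 / real (Suc n)))"
    by metis
  show thesis
  proof
    show "countable (\<Union>d\<in>D. \<Union>n. k d n)"
      using \<open>countable D\<close> finite_k by (intro countable_UN) (auto intro: countable_finite)
    fix x
    show "\<Gamma> x \<subseteq> closure (\<Union>d\<in>D. \<Union>n. k d n)"
    proof (clarsimp simp only: closure_approachable subset_iff)
      fix y and e :: real assume y: "y \<in> \<Gamma> x" and e: "0 < e"
      then have "\<Gamma> x \<inter> ball y (e / 2) \<noteq> {}"
        by (force simp: disjoint_iff)
      then obtain U where U: "open U" "x \<in> U" "\<And>d. d \<in> U \<Longrightarrow> \<Gamma> d \<inter> ball y (e / 2) \<noteq> {}"
        using lhc unfolding lower_hemicontinuous_def by (metis open_ball)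
      then obtain d where d: "d \<in> D" "d \<in> U"
        using open_Int_closure_eq_empty[OF U(1), of D] dense by blast
      then obtain z where z: "z \<in> \<Gamma> d" "dist y z < e / 2"
        using U(3) by fastforce
      obtain n where n: "1 / real (Suc n) < e / 2"
        using nat_approx_posE[of "e / 2"] e by auto
      obtain u where u: "u \<in> k d n" "dist u z < 1 / real (Suc n)"
        using cover[of d n] z by auto
      have "dist u y < e"
        using dist_triangle2[of u y z] u z n by linarith
      with u d show "\<exists>u\<in>\<Union>d\<in>D. \<Union>n. k d n. dist u y < e"
        by blast
    qed
  qed
qed

section \<open>Bounded Borel functions\<close>

definition bounded_borel :: "('x::topological_space \<Rightarrow> real) set" where
  "bounded_borel = {f. f \<in> borel_measurable borel \<and> bounded (range f)}"

lemma bounded_borelI: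
  assumes "f \<in> borel_measurable borel" and "\<And>x. \<bar>f x\<bar> \<le> C"
  shows "f \<in> bounded_borel"
  using assms by (auto simp: bounded_borel_def bounded_iff)

lemma bounded_borel_measurable: "f \<in> bounded_borel \<Longrightarrow> f \<in> borel_measurable borel"
  by (simp add: bounded_borel_def)

lemma bounded_borelE:
  assumes "f \<in> bounded_borel"
  obtains C where "\<And>x. \<bar>f x\<bar> \<le> C"
  using assms by (auto simp: bounded_borel_def bounded_iff)

lemma bounded_borel_diff:
  assumes "f \<in> bounded_borel" and "g \<in> bounded_borel"
  shows "(\<lambda>x. f x - g x) \<in> bounded_borel"
proof -
  obtain C C' where C: "\<And>x. \<bar>f x\<bar> \<le> C" and C': "\<And>x. \<bar>g x\<bar> \<le> C'"
    using assms by (meson bounded_borelE)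
  have "\<bar>f x - g x\<bar> \<le> C + C'" for x
    using C[of x] C'[of x] by linarith
  moreover have "(\<lambda>x. f x - g x) \<in> borel_measurable borel"
    using assms by (intro borel_measurable_diff bounded_borel_measurable)
  ultimately show ?thesis
    by (rule bounded_borelI[rotated])
qed

lemma bounded_borel_indicator: "U \<in> sets borel \<Longrightarrow> indicator U \<in> bounded_borel"
  by (rule bounded_borelI[where C = 1]) (auto simp: indicator_def)

lemma integrable_bounded_borel:
  assumes "prob_space M" and "sets M = sets borel" and "f \<in> bounded_borel"
  shows "integrable M f"
proof -
  interpret prob_space M by fact
  obtain C where "\<And>x. \<bar>f x\<bar> \<le> C"
    using \<open>f \<in> bounded_borel\<close> by (rule bounded_borelE) blast
  moreover have "f \<in> borel_measurable M"
    using bounded_borel_measurable[OF assms(3)] measurable_cong_sets[OF assms(2) refl] by blast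
  ultimately show ?thesis
    by (intro integrable_const_bound[where B = C]) auto
qed

lemma integral_less_bounded_borel:
  assumes "prob_space M" and "sets M = sets borel" and "f \<in> bounded_borel" and "g \<in> bounded_borel"
    and "\<And>x. f x < g x"
  shows "(\<integral>x. f x \<partial>M) < (\<integral>x. g x \<partial>M)"
proof -
  interpret prob_space M by fact
  show ?thesis
    by (rule integral_less_AE_space)
      (use assms in \<open>auto simp: emeasure_space_1 intro: integrable_bounded_borel\<close>)
qed

lemma integral_return_bounded_borel: "f \<in> bounded_borel \<Longrightarrow> (\<integral>y. f y \<partial>return borel x) = f x"
  by (simp add: integral_return bounded_borel_measurable)

section \<open>Markov kernels\<close>

lemma indicator_open_LIMSEQ_continuous:
  fixes U :: "'x::metric_space set"
  assumes "open U"
  obtains f :: "nat \<Rightarrow> 'x \<Rightarrow> real" where "\<And>n. continuous_on UNIV (f n)"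
    and "\<And>n x. \<bar>f n x\<bar> \<le> 1" and "\<And>x. (\<lambda>n. f n x) \<longlonglongrightarrow> indicator U x"
proof (cases "U = UNIV")
  case True
  then show thesis
    by (intro that[of "\<lambda>_ _. 1"]) auto
next
  case False
  define f where "f n x = min 1 (real n * infdist x (- U))" for n x
  show thesis
  proof
    show "continuous_on UNIV (f n)" for n
      unfolding f_def by (intro continuous_intros)
    show "\<bar>f n x\<bar> \<le> 1" for n x
      using infdist_nonneg[of x "- U"] by (auto simp: f_def abs_le_iff)
    show "(\<lambda>n. f n x) \<longlonglongrightarrow> indicator U x" for x
    proof (cases "x \<in> U")
      case True
      then have "0 < infdist x (- U)"
        using infdist_pos_not_in_closed[of "- U" x] \<open>open U\<close> False by auto
      then obtain N where N: "1 < real N * infdist x (- U)"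
        using reals_Archimedean3 by blast
      have "f n x = 1" if "n \<ge> N" for n
        using N mult_right_mono[of "real N" "real n" "infdist x (- U)"] that infdist_nonneg[of x "- U"]
        by (auto simp: f_def)
      then have "eventually (\<lambda>n. f n x = 1) sequentially"
        by (auto simp: eventually_sequentially)
      then show ?thesis
        using True by (simp add: tendsto_eventually)
    qed (simp add: f_def)
  qed
qed

lemma measurable_measure_open_continuousI:
  fixes K :: "'b \<Rightarrow> 'x::metric_space measure"
  assumes prob: "\<And>x. x \<in> space M \<Longrightarrow> prob_space (K x)"
    and sets_K: "\<And>x. x \<in> space M \<Longrightarrow> sets (K x) = sets borel"
    and integral: "\<And>f :: 'x \<Rightarrow> real. continuous_on UNIV f \<Longrightarrow> bounded (range f) \<Longrightarrow>
      (\<lambda>x. \<integral>y. f y \<partial>K x) \<in> borel_measurable M"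
    and "open U"
  shows "(\<lambda>x. measure (K x) U) \<in> borel_measurable M"
proof -
  obtain f :: "nat \<Rightarrow> 'x \<Rightarrow> real" where cont: "\<And>n. continuous_on UNIV (f n)"
    and bound: "\<And>n x. \<bar>f n x\<bar> \<le> 1" and lim: "\<And>x. (\<lambda>n. f n x) \<longlonglongrightarrow> indicator U x"
    using \<open>open U\<close> by (rule indicator_open_LIMSEQ_continuous) blast
  have bounded_borel: "f n \<in> bounded_borel" for n
    using borel_measurable_continuous_onI[OF cont] bound by (rule bounded_borelI)
  show ?thesis
  proof (rule borel_measurable_LIMSEQ_real)
    show "(\<lambda>x. \<integral>y. f n y \<partial>K x) \<in> borel_measurable M" for n
      using cont bounded_borel[of n] by (intro integral) (auto simp: bounded_borel_def)
    fix x assume x: "x \<in> space M"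
    interpret prob_space "K x" by (rule prob[OF x])
    have U_sets: "U \<in> sets (K x)"
      using \<open>open U\<close> sets_K[OF x] by simp
    have "(\<lambda>n. \<integral>y. f n y \<partial>K x) \<longlonglongrightarrow> (\<integral>y. indicator U y \<partial>K x)"
    proof (rule integral_dominated_convergence[where w = "\<lambda>_. 1"])
      show "f n \<in> borel_measurable (K x)" for n
        using integrable_bounded_borel[OF prob[OF x] sets_K[OF x] bounded_borel] by simp
    qed (use U_sets lim bound in auto)
    then show "(\<lambda>n. \<integral>y. f n y \<partial>K x) \<longlonglongrightarrow> measure (K x) U"
      using U_sets by simp
  qed
qed

lemma measurable_prob_algebra_continuousI:
  fixes K :: "'b \<Rightarrow> 'x::metric_space measure"
  assumes prob: "\<And>x. x \<in> space M \<Longrightarrow> prob_space (K x)"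
    and sets_K: "\<And>x. x \<in> space M \<Longrightarrow> sets (K x) = sets borel"
    and integral: "\<And>f :: 'x \<Rightarrow> real. continuous_on UNIV f \<Longrightarrow> bounded (range f) \<Longrightarrow>
      (\<lambda>x. \<integral>y. f y \<partial>K x) \<in> borel_measurable M"
  shows "K \<in> M \<rightarrow>\<^sub>M prob_algebra borel"
proof (rule measurable_prob_algebra_generated[where \<Omega> = UNIV and G = "Collect open"])
  show "sets borel = sigma_sets UNIV (Collect (open :: 'x set \<Rightarrow> bool))"
    by (simp add: borel_def)
  show "Int_stable (Collect (open :: 'x set \<Rightarrow> bool))"
    by (auto simp: Int_stable_def)
  fix U :: "'x set" assume "U \<in> Collect open"
  then have "(\<lambda>x. measure (K x) U) \<in> borel_measurable M"
    using prob sets_K integral by (intro measurable_measure_open_continuousI) auto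
  moreover have "emeasure (K x) U = ennreal (measure (K x) U)" if "x \<in> space M" for x
    using prob[OF that] by (intro finite_measure.emeasure_eq_measure prob_space.finite_measure)
  ultimately show "(\<lambda>x. emeasure (K x) U) \<in> borel_measurable M"
    by (subst measurable_cong[where g = "\<lambda>x. ennreal (measure (K x) U)"]) auto
qed (use prob sets_K in auto)

locale markov_policy =
  fixes P :: "'x::topological_space \<Rightarrow> 'a \<Rightarrow> 'x measure" and s :: "'x \<Rightarrow> 'a"
  assumes kernel: "(\<lambda>x. P x (s x)) \<in> borel \<rightarrow>\<^sub>M prob_algebra borel"
begin

lemma prob_space_kernel: "prob_space (P x (s x))"
  and sets_kernel: "sets (P x (s x)) = sets borel"
  using measurable_space[OF kernel, of x] by (auto simp: space_prob_algebra)

lemma integrable_kernel: "f \<in> bounded_borel \<Longrightarrow> integrable (P x (s x)) f"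
  by (rule integrable_bounded_borel[OF prob_space_kernel sets_kernel])

lemma Pop_const: "Pop P s (\<lambda>_. c) x = c"
  using prob_space.prob_space[OF prob_space_kernel] by (simp add: Pop_def)

lemma Pop_mono:
  assumes "f \<in> bounded_borel" and "g \<in> bounded_borel" and "\<And>y. f y \<le> g y"
  shows "Pop P s f x \<le> Pop P s g x"
  unfolding Pop_def using assms by (intro integral_mono integrable_kernel)

lemma Pop_ge:
  assumes "f \<in> bounded_borel" and "\<And>y. c \<le> f y"
  shows "c \<le> Pop P s f x"
  using Pop_mono[of "\<lambda>_. c" f x] assms by (simp add: Pop_const bounded_borel_def)

lemma Pop_abs_le:
  assumes "f \<in> borel_measurable borel" and "\<And>y. \<bar>f y\<bar> \<le> C"
  shows "\<bar>Pop P s f x\<bar> \<le> C"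
proof -
  have f: "f \<in> bounded_borel"
    using assms by (rule bounded_borelI)
  have "Pop P s f x \<le> Pop P s (\<lambda>_. C) x"
    using f assms(2) by (intro Pop_mono) (auto simp: bounded_borel_def abs_le_iff)
  moreover have "- C \<le> Pop P s f x"
    using f assms(2) by (intro Pop_ge) (auto simp: abs_le_iff minus_le_iff)
  ultimately show ?thesis
    by (simp add: Pop_const abs_le_iff)
qed

lemma Pop_measurable:
  assumes "f \<in> borel_measurable borel"
  shows "Pop P s f \<in> borel_measurable borel"
  unfolding Pop_def[abs_def]
  by (rule measurable_compose[OF measurable_prob_algebraD[OF kernel]
        integral_measurable_subprob_algebra[OF assms]])

lemma Pop_bounded_borel:
  assumes "f \<in> bounded_borel"
  shows "Pop P s f \<in> bounded_borel"
proof -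
  obtain C where "\<And>x. \<bar>f x\<bar> \<le> C"
    using assms by (rule bounded_borelE) blast
  then show ?thesis
    using bounded_borel_measurable[OF assms] by (intro bounded_borelI Pop_measurable Pop_abs_le)
qed

lemma Pop_diff:
  assumes "f \<in> bounded_borel" and "g \<in> bounded_borel"
  shows "Pop P s (\<lambda>y. f y - g y) x = Pop P s f x - Pop P s g x"
  unfolding Pop_def using assms by (intro Bochner_Integration.integral_diff integrable_kernel)

lemma Pop_sum:
  assumes "\<And>i. i \<in> I \<Longrightarrow> f i \<in> bounded_borel"
  shows "Pop P s (\<lambda>y. \<Sum>i\<in>I. f i y) x = (\<Sum>i\<in>I. Pop P s (f i) x)"
  unfolding Pop_def using assms by (intro Bochner_Integration.integral_sum integrable_kernel)

lemma Pop_suminf: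
  assumes f: "\<And>t. f t \<in> borel_measurable borel" and bound: "\<And>t y. \<bar>f t y\<bar> \<le> g t"
    and "summable g"
  shows "Pop P s (\<lambda>y. \<Sum>t. f t y) x = (\<Sum>t. Pop P s (f t) x)"
  unfolding Pop_def
proof (rule integral_suminf)
  show "integrable (P x (s x)) (f t)" for t
    using f bound by (intro integrable_kernel bounded_borelI)
  show "AE y in P x (s x). summable (\<lambda>t. norm (f t y))"
    by (intro AE_I2 summable_comparison_test'[OF \<open>summable g\<close>, of 0]) (use bound in auto)
  have "\<bar>\<integral>y. norm (f t y) \<partial>P x (s x)\<bar> \<le> g t" for t
    unfolding Pop_def[symmetric] using f bound by (intro Pop_abs_le) auto
  then show "summable (\<lambda>t. \<integral>y. norm (f t y) \<partial>P x (s x))"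
    by (intro summable_comparison_test'[OF \<open>summable g\<close>, of 0]) auto
qed

lemma Pop_eq_0_imp_AE_eq_0:
  assumes "f \<in> bounded_borel" and "\<And>y. 0 \<le> f y" and "Pop P s f x = 0"
  shows "AE y in P x (s x). f y = 0"
  using integral_nonneg_eq_0_iff_AE[OF integrable_kernel[OF assms(1)]] assms(2,3)
  by (auto simp: Pop_def)

lemma funpow_Pop_bounded_borel: "f \<in> bounded_borel \<Longrightarrow> (Pop P s ^^ n) f \<in> bounded_borel"
  by (induction n) (auto intro: Pop_bounded_borel)

lemma funpow_Pop_abs_le:
  assumes "f \<in> borel_measurable borel" and "\<And>y. \<bar>f y\<bar> \<le> C"
  shows "\<bar>(Pop P s ^^ n) f x\<bar> \<le> C"
proof (induction n arbitrary: x)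
  case (Suc n)
  have "(Pop P s ^^ n) f \<in> borel_measurable borel"
    using funpow_Pop_bounded_borel[OF bounded_borelI[OF assms]] by (rule bounded_borel_measurable)
  with Suc show ?case
    by (simp add: Pop_abs_le)
qed (use assms in simp)

lemma funpow_Pop_sum:
  assumes "\<And>i. i \<in> I \<Longrightarrow> f i \<in> bounded_borel"
  shows "(Pop P s ^^ n) (\<lambda>y. \<Sum>i\<in>I. f i y) = (\<lambda>x. \<Sum>i\<in>I. (Pop P s ^^ n) (f i) x)"
  using assms by (induction n) (auto simp: Pop_sum funpow_Pop_bounded_borel)

lemma kpow_nonneg: "0 \<le> kpow P s n x G"
proof -
  have "\<forall>x. 0 \<le> (Pop P s ^^ n) (indicator G) x"
    by (induction n) (auto simp: Pop_def intro!: integral_nonneg_AE)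
  then show ?thesis
    by (simp add: kpow_def)
qed

lemma sum_kpow_disjoint_le_1:
  assumes "finite \<U>" and "pairwise disjnt \<U>" and "\<U> \<subseteq> sets borel"
  shows "(\<Sum>U\<in>\<U>. kpow P s n x U) \<le> 1"
proof -
  have "(\<Sum>U\<in>\<U>. kpow P s n x U) = (Pop P s ^^ n) (\<lambda>y. \<Sum>U\<in>\<U>. indicator U y) x"
    unfolding kpow_def using assms(3) by (subst funpow_Pop_sum) (auto intro: bounded_borel_indicator)
  also have "(\<lambda>y. \<Sum>U\<in>\<U>. indicator U y) = (indicator (\<Union>U\<in>\<U>. U) :: 'x \<Rightarrow> real)"
  proof
    have "disjoint_family_on (\<lambda>U. U) \<U>"
      using assms(2) by (auto simp: disjoint_family_on_def pairwise_def disjnt_def)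
    then show "(\<Sum>U\<in>\<U>. indicator U y) = (indicator (\<Union>U\<in>\<U>. U) y :: real)" for y
      using assms(1) by (intro indicator_UN_disjoint[symmetric])
  qed
  also have "\<bar>(Pop P s ^^ n) (indicator (\<Union>U\<in>\<U>. U)) x\<bar> \<le> 1"
    using assms by (intro funpow_Pop_abs_le borel_measurable_indicator)
      (auto simp: indicator_def intro!: sets.finite_Union)
  finally show ?thesis
    by linarith
qed

lemma countable_disjoint_kpow_nonzero:
  assumes "pairwise disjnt \<U>" and "\<U> \<subseteq> sets borel"
  shows "countable {U \<in> \<U>. kpow P s n x U \<noteq> 0}"
proof (rule summable_countable_real, rule nonneg_bdd_above_summable_on)
  have "(\<Sum>U\<in>F. kpow P s n x U) \<le> 1" if "F \<subseteq> \<U>" "finite F" for F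
    using that assms pairwise_subset by (intro sum_kpow_disjoint_le_1) blast+
  then show "bdd_above (sum (kpow P s n x) ` {F. F \<subseteq> \<U> \<and> finite F})"
    by (intro bdd_aboveI[of _ 1]) auto
qed (rule kpow_nonneg)

lemma countable_disjoint_open_if_irreducible:
  fixes \<U> :: "'x set set"
  assumes irr: "open_set_irreducible (kpow P s)"
    and opens: "\<And>U. U \<in> \<U> \<Longrightarrow> open U" and disjoint: "pairwise disjnt \<U>"
  shows "countable \<U>"
proof (rule countable_subset)
  fix x :: 'x
  show "\<U> \<subseteq> insert {} (\<Union>n. {U \<in> \<U>. kpow P s n x U \<noteq> 0})"
  proof
    fix U assume "U \<in> \<U>"
    show "U \<in> insert {} (\<Union>n. {U \<in> \<U>. kpow P s n x U \<noteq> 0})"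
    proof (cases "U = {}")
      case False
      then obtain n where "0 < kpow P s n x U"
        using irr opens[OF \<open>U \<in> \<U>\<close>] unfolding open_set_irreducible_def reachable_def by blast
      then have "kpow P s n x U \<noteq> 0"
        by simp
      with \<open>U \<in> \<U>\<close> show ?thesis
        by blast
    qed simp
  qed
  show "countable (insert {} (\<Union>n. {U \<in> \<U>. kpow P s n x U \<noteq> 0}))"
    using opens disjoint by (intro countable_insert countable_UN countable_disjoint_kpow_nonzero) auto
qed

lemma kpow_eq_0_if_absorbing:
  assumes absorbing: "\<And>x. x \<in> Z \<Longrightarrow> AE y in P x (s x). y \<in> Z" and "Z \<inter> U = {}" and "x \<in> Z"
  shows "kpow P s n x U = 0"
proof -
  have "\<forall>x\<in>Z. (Pop P s ^^ n) (indicator U) x = 0"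
  proof (induction n)
    case 0
    then show ?case
      using assms(2) by (auto simp: indicator_def)
  next
    case (Suc n)
    show ?case
    proof
      fix x assume "x \<in> Z"
      have "AE y in P x (s x). (Pop P s ^^ n) (indicator U) y = 0"
        using absorbing[OF \<open>x \<in> Z\<close>] by eventually_elim (use Suc in blast)
      then show "(Pop P s ^^ Suc n) (indicator U) x = 0"
        by (simp add: Pop_def integral_eq_zero_AE)
    qed
  qed
  with assms(3) show ?thesis
    by (simp add: kpow_def)
qed

lemma superharmonic_pos_if_reached:
  assumes w: "w \<in> bounded_borel" and nonneg: "\<And>y. 0 \<le> w y" and "0 < c"
    and on: "\<And>y. y \<in> U \<Longrightarrow> 0 < w y" and off: "\<And>y. y \<notin> U \<Longrightarrow> c * Pop P s w y \<le> w y"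
    and reached: "0 < kpow P s n x U"
  shows "0 < w x"
proof -
  have disjoint: "{y. w y = 0} \<inter> U = {}"
    using on by force
  have absorbing: "AE z in P y (s y). z \<in> {y. w y = 0}" if "y \<in> {y. w y = 0}" for y
  proof -
    have "c * Pop P s w y \<le> 0"
      using off[of y] that disjoint by auto
    then have "Pop P s w y = 0"
      using Pop_ge[OF w nonneg, of y] \<open>0 < c\<close> by (simp add: mult_le_0_iff)
    then show ?thesis
      using Pop_eq_0_imp_AE_eq_0[OF w nonneg] by simp
  qed
  have "w x \<noteq> 0"
    using kpow_eq_0_if_absorbing[OF absorbing disjoint, of x n] reached by auto
  then show ?thesis
    using nonneg[of x] by simp
qed

lemma discounted_comparison:
  assumes f: "f \<in> bounded_borel" and g: "g \<in> bounded_borel" and "0 \<le> \<beta>" and "\<beta> < 1"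
    and le: "\<And>x. f x - \<beta> * Pop P s f x \<le> g x - \<beta> * Pop P s g x"
  shows "f x \<le> g x"
proof -
  define h where "h y = g y - f y" for y
  define m where "m = (INF y. h y)"
  have h: "h \<in> bounded_borel"
    unfolding h_def[abs_def] using g f by (rule bounded_borel_diff)
  then have "bdd_below (range h)"
    by (simp add: bounded_borel_def bounded_imp_bdd_below)
  then have m_le: "m \<le> h y" for y
    unfolding m_def by (auto intro: cINF_lower)
  have "\<beta> * m \<le> h y" for y
    using mult_left_mono[OF Pop_ge[OF h m_le] \<open>0 \<le> \<beta>\<close>, of y] le[of y] Pop_diff[OF g f, of y]
    by (simp add: h_def[abs_def] right_diff_distrib)
  then have "\<beta> * m \<le> m"
    unfolding m_def by (intro cINF_greatest) auto
  then have "0 \<le> (1 - \<beta>) * m"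
    by (simp add: algebra_simps)
  then have "0 \<le> m"
    using \<open>\<beta> < 1\<close> by (simp add: zero_le_mult_iff)
  then show ?thesis
    using m_le[of x] by (simp add: h_def)
qed

end

section \<open>The value of a policy\<close>

definition advantage ::
  "('x \<Rightarrow> 'a \<Rightarrow> real) \<Rightarrow> real \<Rightarrow> ('x \<Rightarrow> 'a \<Rightarrow> 'x measure) \<Rightarrow> ('x \<Rightarrow> real) \<Rightarrow> 'x \<Rightarrow> 'a \<Rightarrow> real" where
  "advantage r \<beta> P v x a = r x a + \<beta> * (\<integral>y. v y \<partial>P x a) - v x"

locale discounted_policy = markov_policy P s
  for P :: "'x::topological_space \<Rightarrow> 'a \<Rightarrow> 'x measure" and s :: "'x \<Rightarrow> 'a" +
  fixes r :: "'x \<Rightarrow> 'a \<Rightarrow> real" and \<beta> :: real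
  assumes discount: "0 < \<beta>" "\<beta> < 1"
    and reward: "(\<lambda>y. r y (s y)) \<in> bounded_borel"
begin

abbreviation discounted_reward :: "nat \<Rightarrow> 'x \<Rightarrow> real" where
  "discounted_reward t x \<equiv> \<beta> ^ t * (Pop P s ^^ t) (\<lambda>y. r y (s y)) x"

lemma discounted_reward_measurable: "discounted_reward t \<in> borel_measurable borel"
  by (intro borel_measurable_times borel_measurable_const bounded_borel_measurable
      funpow_Pop_bounded_borel reward)

lemma discounted_reward_abs_le:
  assumes "\<And>y. \<bar>r y (s y)\<bar> \<le> C"
  shows "\<bar>discounted_reward t x\<bar> \<le> \<beta> ^ t * C"
  using funpow_Pop_abs_le[OF bounded_borel_measurable[OF reward] assms] discount
  by (simp add: abs_mult mult_left_mono)

lemma summable_discount: "summable (\<lambda>t. \<beta> ^ t * C)"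
  using discount by (intro summable_mult2 summable_geometric) simp

lemma vpol_abs_le:
  assumes "\<And>y. \<bar>r y (s y)\<bar> \<le> C"
  shows "\<bar>vpol r \<beta> P s x\<bar> \<le> C / (1 - \<beta>)"
proof -
  have "norm (vpol r \<beta> P s x) \<le> (\<Sum>t. \<beta> ^ t * C)"
    unfolding vpol_def using discounted_reward_abs_le[OF assms]
    by (intro norm_suminf_le summable_discount) simp
  also have "\<dots> = C / (1 - \<beta>)"
    using discount suminf_mult2[of "\<lambda>t. \<beta> ^ t" C] by (simp add: suminf_geometric summable_geometric)
  finally show ?thesis
    by simp
qed

lemma vpol_bounded_borel: "vpol r \<beta> P s \<in> bounded_borel"
proof -
  obtain C where "\<And>y. \<bar>r y (s y)\<bar> \<le> C"
    using reward by (rule bounded_borelE) blast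
  then have "\<bar>vpol r \<beta> P s x\<bar> \<le> C / (1 - \<beta>)" for x
    by (rule vpol_abs_le)
  moreover have "vpol r \<beta> P s \<in> borel_measurable borel"
    unfolding vpol_def[abs_def] by (rule borel_measurable_suminf[OF discounted_reward_measurable])
  ultimately show ?thesis
    by (rule bounded_borelI[rotated])
qed

lemma vpol_fixpoint: "vpol r \<beta> P s x = r x (s x) + \<beta> * Pop P s (vpol r \<beta> P s) x"
proof -
  obtain C where C: "\<And>y. \<bar>r y (s y)\<bar> \<le> C"
    using reward by (rule bounded_borelE) blast
  have abs_le: "\<bar>discounted_reward t y\<bar> \<le> \<beta> ^ t * C" for t y
    by (rule discounted_reward_abs_le[OF C])
  have summable: "summable (\<lambda>t. discounted_reward t y)" for y
    using abs_le by (intro summable_comparison_test'[OF summable_discount, of 0]) simp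
  have Pop_term: "\<beta> * Pop P s (discounted_reward t) x = discounted_reward (Suc t) x" for t
    by (simp add: Pop_def)
  have "vpol r \<beta> P s x = r x (s x) + (\<Sum>t. discounted_reward (Suc t) x)"
    unfolding vpol_def using suminf_split_head[OF summable] by simp
  also have "(\<Sum>t. discounted_reward (Suc t) x) = (\<Sum>t. \<beta> * Pop P s (discounted_reward t) x)"
    unfolding Pop_term ..
  also have "\<dots> = \<beta> * (\<Sum>t. Pop P s (discounted_reward t) x)"
  proof (rule suminf_mult, rule summable_comparison_test'[OF summable_discount, of 0])
    show "norm (Pop P s (discounted_reward t) x) \<le> \<beta> ^ t * C" for t
      using Pop_abs_le[OF discounted_reward_measurable abs_le] by simp
  qed
  also have "(\<Sum>t. Pop P s (discounted_reward t) x) = Pop P s (\<lambda>y. \<Sum>t. discounted_reward t y) x"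
    by (rule Pop_suminf[OF discounted_reward_measurable abs_le summable_discount, symmetric])
  finally show ?thesis
    by (simp add: vpol_def[abs_def])
qed

lemma advantage_policy: "advantage r \<beta> P v x (s x) = r x (s x) + \<beta> * Pop P s v x - v x"
  by (simp add: advantage_def Pop_def)

lemma advantage_vpol_self: "advantage r \<beta> P (vpol r \<beta> P s) x (s x) = 0"
  using vpol_fixpoint[of x] by (simp add: advantage_policy)

lemma vpol_le_if_advantage_nonpos:
  assumes "v \<in> bounded_borel" and "\<And>x. advantage r \<beta> P v x (s x) \<le> 0"
  shows "vpol r \<beta> P s x \<le> v x"
proof (rule discounted_comparison[OF vpol_bounded_borel assms(1) less_imp_le[OF discount(1)] discount(2)])
  show "vpol r \<beta> P s y - \<beta> * Pop P s (vpol r \<beta> P s) y \<le> v y - \<beta> * Pop P s v y" for y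
    using assms(2)[of y] vpol_fixpoint[of y] by (simp add: advantage_policy)
qed

lemma le_vpol_if_advantage_nonneg:
  assumes "v \<in> bounded_borel" and "\<And>x. 0 \<le> advantage r \<beta> P v x (s x)"
  shows "v x \<le> vpol r \<beta> P s x"
proof (rule discounted_comparison[OF assms(1) vpol_bounded_borel less_imp_le[OF discount(1)] discount(2)])
  show "v y - \<beta> * Pop P s v y \<le> vpol r \<beta> P s y - \<beta> * Pop P s (vpol r \<beta> P s) y" for y
    using assms(2)[of y] vpol_fixpoint[of y] by (simp add: advantage_policy)
qed

lemma vpol_diff_eq:
  assumes "v \<in> bounded_borel"
  shows "vpol r \<beta> P s x - v x
    = advantage r \<beta> P v x (s x) + \<beta> * Pop P s (\<lambda>y. vpol r \<beta> P s y - v y) x"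
  using vpol_fixpoint[of x] Pop_diff[OF vpol_bounded_borel assms, of x]
  by (simp add: advantage_policy right_diff_distrib)

lemma continuous_on_vpol:
  assumes feller: "\<And>f. continuous_on UNIV f \<Longrightarrow> bounded (range f) \<Longrightarrow> continuous_on UNIV (Pop P s f)"
    and reward_cont: "continuous_on UNIV (\<lambda>y. r y (s y))"
  shows "continuous_on UNIV (vpol r \<beta> P s)"
proof -
  obtain C where C: "\<And>y. \<bar>r y (s y)\<bar> \<le> C"
    using reward by (rule bounded_borelE) blast
  have "continuous_on UNIV ((Pop P s ^^ t) (\<lambda>y. r y (s y)))" for t
  proof (induction t)
    case (Suc t)
    have "bounded (range ((Pop P s ^^ t) (\<lambda>y. r y (s y))))"
      using funpow_Pop_bounded_borel[OF reward] by (simp add: bounded_borel_def)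
    with Suc show ?case
      by (simp add: feller)
  qed (use reward_cont in simp)
  then have "continuous_on UNIV (\<lambda>x. \<Sum>t<n. discounted_reward t x)" for n
    by (intro continuous_on_sum continuous_on_mult_left)
  moreover have "uniform_limit UNIV (\<lambda>n x. \<Sum>t<n. discounted_reward t x) (vpol r \<beta> P s) sequentially"
    unfolding vpol_def[abs_def] using discounted_reward_abs_le[OF C]
    by (intro Weierstrass_m_test[OF _ summable_discount]) simp
  ultimately show ?thesis
    by (intro uniform_limit_theorem[rotated]) auto
qed

end

lemma vpol_less_if_improvement_reached:
  assumes "discounted_policy P s r \<beta>" and "discounted_policy P \<sigma> r \<beta>"
    and off: "\<And>x. x \<notin> U \<Longrightarrow> s x = \<sigma> x"
    and on: "\<And>x. x \<in> U \<Longrightarrow> 0 < advantage r \<beta> P (vpol r \<beta> P \<sigma>) x (s x)"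
    and reached: "0 < kpow P \<sigma> n x U"
  shows "vpol r \<beta> P \<sigma> x < vpol r \<beta> P s x"
proof -
  interpret s: discounted_policy P s r \<beta> by fact
  interpret \<sigma>: discounted_policy P \<sigma> r \<beta> by fact
  define A where "A x = advantage r \<beta> P (vpol r \<beta> P \<sigma>) x (s x)" for x
  define w where "w x = vpol r \<beta> P s x - vpol r \<beta> P \<sigma> x" for x
  have A_nonneg: "0 \<le> A x" for x
    using on[of x] off[of x] \<sigma>.advantage_vpol_self[of x] by (cases "x \<in> U") (auto simp: A_def)
  then have w_nonneg: "0 \<le> w x" for x
    using s.le_vpol_if_advantage_nonneg[OF \<sigma>.vpol_bounded_borel] by (simp add: A_def w_def)
  have w: "w \<in> bounded_borel"
    unfolding w_def[abs_def] by (intro bounded_borel_diff s.vpol_bounded_borel \<sigma>.vpol_bounded_borel)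
  have w_eq: "w x = A x + \<beta> * Pop P s w x" for x
    unfolding w_def[abs_def] A_def by (rule s.vpol_diff_eq[OF \<sigma>.vpol_bounded_borel])
  have \<beta>_Pop_nonneg: "0 \<le> \<beta> * Pop P s w x" for x
    using s.Pop_ge[OF w w_nonneg] s.discount by simp
  have "0 < w x"
  proof (rule \<sigma>.superharmonic_pos_if_reached[OF w w_nonneg \<sigma>.discount(1) _ _ reached])
    show "0 < w y" if "y \<in> U" for y
      using w_eq[of y] \<beta>_Pop_nonneg[of y] on[OF that] by (simp add: A_def)
    show "\<beta> * Pop P \<sigma> w y \<le> w y" if "y \<notin> U" for y
      using w_eq[of y] A_nonneg[of y] off[OF that] by (simp add: Pop_def)
  qed
  then show ?thesis
    by (simp add: w_def)
qed

section \<open>Markov decision processes\<close>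

lemma measurable_compose_policy_graph:
  assumes s: "s \<in> policies \<Gamma>" and graph: "(\<lambda>x. (x, s x)) \<in> borel_measurable borel"
    and f: "continuous_on (graphG \<Gamma>) f"
  shows "(\<lambda>x. f (x, s x)) \<in> borel_measurable borel"
proof -
  have "(\<lambda>x. (x, s x)) \<in> borel \<rightarrow>\<^sub>M restrict_space borel (graphG \<Gamma>)"
    using graph s by (intro measurable_restrict_space2) (auto simp: graphG_def policies_def)
  from measurable_compose[OF this borel_measurable_continuous_on_restrict[OF f]] show ?thesis .
qed

lemma continuous_on_compose_policy_graph:
  assumes "s \<in> policies \<Gamma>" and "continuous_on UNIV s" and "continuous_on (graphG \<Gamma>) f"
  shows "continuous_on UNIV (\<lambda>x. f (x, s x))"
  by (rule continuous_on_compose2[OF assms(3)])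
    (use assms in \<open>auto simp: graphG_def policies_def intro!: continuous_intros\<close>)

lemma lower_hemicontinuous_pos_neighbourhood:
  fixes \<Gamma> :: "'x::topological_space \<Rightarrow> 'a::metric_space set" and f :: "'x \<times> 'a \<Rightarrow> real"
  assumes lhc: "lower_hemicontinuous \<Gamma>" and f: "continuous_on (graphG \<Gamma>) f"
    and "a \<in> \<Gamma> x" and "0 < f (x, a)"
  obtains U e where "open U" and "x \<in> U" and "\<And>y. y \<in> U \<Longrightarrow> \<Gamma> y \<inter> cball a e \<noteq> {}"
    and "\<And>y b. y \<in> U \<Longrightarrow> b \<in> \<Gamma> y \<inter> cball a e \<Longrightarrow> 0 < f (y, b)"
proof -
  obtain W where W: "open W" "W \<inter> graphG \<Gamma> = f -` {0<..} \<inter> graphG \<Gamma>"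
    using f open_greaterThan[of "0::real"] unfolding continuous_on_open_invariant by metis
  then have "(x, a) \<in> W"
    using assms(3,4) by (auto simp: graphG_def)
  from open_prod_elim[OF W(1) this] obtain V1 V2
    where V: "open V1" "open V2" "(x, a) \<in> V1 \<times> V2" "V1 \<times> V2 \<subseteq> W" .
  then obtain e where e: "0 < e" "cball a e \<subseteq> V2"
    by (auto simp: open_contains_cball)
  then have "\<Gamma> x \<inter> ball a e \<noteq> {}"
    using \<open>a \<in> \<Gamma> x\<close> by (force simp: disjoint_iff)
  then obtain V3 where V3: "open V3" "x \<in> V3" "\<And>y. y \<in> V3 \<Longrightarrow> \<Gamma> y \<inter> ball a e \<noteq> {}"
    using lhc unfolding lower_hemicontinuous_def by (metis open_ball)
  show thesis
  proof
    show "open (V1 \<inter> V3)" and "x \<in> V1 \<inter> V3"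
      using V V3 by auto
    show "\<Gamma> y \<inter> cball a e \<noteq> {}" if "y \<in> V1 \<inter> V3" for y
      using V3(3)[of y] that ball_subset_cball[of a e] by blast
    show "0 < f (y, b)" if "y \<in> V1 \<inter> V3" "b \<in> \<Gamma> y \<inter> cball a e" for y b
    proof -
      have "(y, b) \<in> W \<inter> graphG \<Gamma>"
        using that e V by (auto simp: graphG_def)
      then show ?thesis
        unfolding W(2) by simp
    qed
  qed
qed

locale markov_decision_process =
  fixes r :: "'x::metric_space \<Rightarrow> 'a::metric_space \<Rightarrow> real"
    and \<Gamma> :: "'x \<Rightarrow> 'a set" and \<beta> :: real and P :: "'x \<Rightarrow> 'a \<Rightarrow> 'x measure"
  assumes mdp: "is_mdp r \<Gamma> \<beta> P"
begin

lemma compact_feasible: "compact (\<Gamma> x)"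
  and upper_hemicontinuous_feasible: "upper_hemicontinuous \<Gamma>"
  and lower_hemicontinuous_feasible: "lower_hemicontinuous \<Gamma>"
  using mdp by (auto simp: is_mdp_def continuous_correspondence_def)

lemma continuous_on_reward: "continuous_on (graphG \<Gamma>) (\<lambda>p. r (fst p) (snd p))"
  using mdp by (simp add: is_mdp_def)

lemma reward_bounded:
  obtains C where "\<And>x a. a \<in> \<Gamma> x \<Longrightarrow> \<bar>r x a\<bar> \<le> C"
proof -
  have "bounded ((\<lambda>p. r (fst p) (snd p)) ` graphG \<Gamma>)"
    using mdp by (simp add: is_mdp_def)
  then show thesis
    using that by (force simp: bounded_iff graphG_def)
qed

lemma continuous_on_expectation:
  assumes "continuous_on UNIV v" and "bounded (range (v :: 'x \<Rightarrow> real))"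
  shows "continuous_on (graphG \<Gamma>) (\<lambda>p. \<integral>y. v y \<partial>P (fst p) (snd p))"
  using mdp assms by (simp add: is_mdp_def)

lemma continuous_on_advantage:
  assumes v: "continuous_on UNIV v" "bounded (range v)"
  shows "continuous_on (graphG \<Gamma>) (\<lambda>p. advantage r \<beta> P v (fst p) (snd p))"
proof -
  have "continuous_on (graphG \<Gamma>) (\<lambda>p. v (fst p))"
    by (rule continuous_on_compose2[OF v(1)]) (auto intro: continuous_intros)
  then show ?thesis
    unfolding advantage_def
    by (intro continuous_on_add continuous_on_diff continuous_on_mult_left
        continuous_on_reward continuous_on_expectation v)
qed

lemma discounted_policyI:
  assumes s: "s \<in> policies \<Gamma>" and graph: "(\<lambda>x. (x, s x)) \<in> borel_measurable borel"
  shows "discounted_policy P s r \<beta>"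
proof
  have feasible: "s x \<in> \<Gamma> x" for x
    using s by (simp add: policies_def)
  show "0 < \<beta>" "\<beta> < 1"
    using mdp by (auto simp: is_mdp_def)
  obtain C where "\<And>x a. a \<in> \<Gamma> x \<Longrightarrow> \<bar>r x a\<bar> \<le> C"
    by (rule reward_bounded) blast
  then show "(\<lambda>y. r y (s y)) \<in> bounded_borel"
    using measurable_compose_policy_graph[OF s graph continuous_on_reward] feasible
    by (intro bounded_borelI) auto
  show "(\<lambda>x. P x (s x)) \<in> borel \<rightarrow>\<^sub>M prob_algebra borel"
  proof (rule measurable_prob_algebra_continuousI)
    show "prob_space (P x (s x))" "sets (P x (s x)) = sets borel" for x
      using mdp feasible by (auto simp: is_mdp_def)
    show "(\<lambda>x. \<integral>y. f y \<partial>P x (s x)) \<in> borel_measurable borel"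
      if "continuous_on UNIV f" "bounded (range f)" for f :: "'x \<Rightarrow> real"
      using measurable_compose_policy_graph[OF s graph continuous_on_expectation[OF that]] by simp
  qed
qed

lemma discounted_policy_continuous:
  assumes "\<sigma> \<in> policies \<Gamma>" and "continuous_on UNIV \<sigma>"
  shows "discounted_policy P \<sigma> r \<beta>"
  using assms by (intro discounted_policyI borel_measurable_continuous_onI continuous_intros)

lemma continuous_on_vpol:
  assumes "\<sigma> \<in> policies \<Gamma>" and "continuous_on UNIV \<sigma>"
  shows "continuous_on UNIV (vpol r \<beta> P \<sigma>)"
proof (rule discounted_policy.continuous_on_vpol[OF discounted_policy_continuous[OF assms]])
  show "continuous_on UNIV (\<lambda>y. r y (\<sigma> y))"
    using continuous_on_compose_policy_graph[OF assms continuous_on_reward] by simp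
  show "continuous_on UNIV (Pop P \<sigma> f)"
    if "continuous_on UNIV f" "bounded (range f)" for f
    using continuous_on_compose_policy_graph[OF assms continuous_on_expectation[OF that]]
    by (simp add: Pop_def[abs_def])
qed

end

locale separable_markov_decision_process = markov_decision_process r \<Gamma> \<beta> P
  for r :: "'x::metric_space \<Rightarrow> 'a::metric_space \<Rightarrow> real"
    and \<Gamma> :: "'x \<Rightarrow> 'a set" and \<beta> :: real and P :: "'x \<Rightarrow> 'a \<Rightarrow> 'x measure" +
  assumes separable: "\<exists>D :: 'x set. countable D \<and> closure D = UNIV"
begin

lemma discounted_policy:
  assumes "s \<in> policies \<Gamma>"
  shows "discounted_policy P s r \<beta>"
proof (rule discounted_policyI[OF assms])
  obtain D :: "'x set" where "countable D" "closure D = UNIV"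
    using separable by blast
  then obtain \<B> :: "'x set set" where "countable \<B>" "topological_basis \<B>"
    by (rule countable_dense_imp_countable_basis)
  then show "(\<lambda>x. (x, s x)) \<in> borel_measurable borel"
    using assms by (intro borel_measurable_graph) (auto simp: policies_def)
qed

lemma vpol_bounded_borel: "s \<in> policies \<Gamma> \<Longrightarrow> vpol r \<beta> P s \<in> bounded_borel"
  by (rule discounted_policy.vpol_bounded_borel[OF discounted_policy])

lemma bdd_above_vpol: "bdd_above ((\<lambda>s. vpol r \<beta> P s x) ` policies \<Gamma>)"
proof -
  obtain C where C: "\<And>x a. a \<in> \<Gamma> x \<Longrightarrow> \<bar>r x a\<bar> \<le> C"
    by (rule reward_bounded) blast
  have "vpol r \<beta> P s x \<le> C / (1 - \<beta>)" if s: "s \<in> policies \<Gamma>" for s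
  proof -
    have "\<bar>r y (s y)\<bar> \<le> C" for y
      using s C by (simp add: policies_def)
    then show ?thesis
      using discounted_policy.vpol_abs_le[OF discounted_policy[OF s]] by (simp add: abs_le_iff)
  qed
  then show ?thesis
    by (rule bdd_aboveI2)
qed

lemma optimal_policy_iff:
  assumes "\<sigma> \<in> policies \<Gamma>"
  shows "optimal_policy r \<Gamma> \<beta> P \<sigma> \<longleftrightarrow> (\<forall>s\<in>policies \<Gamma>. \<forall>x. vpol r \<beta> P s x \<le> vpol r \<beta> P \<sigma> x)"
proof
  assume optimal: "optimal_policy r \<Gamma> \<beta> P \<sigma>"
  have "vpol r \<beta> P s x \<le> vstar r \<Gamma> \<beta> P x" if "s \<in> policies \<Gamma>" for s x
    unfolding vstar_def using that bdd_above_vpol by (rule cSUP_upper)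
  with optimal show "\<forall>s\<in>policies \<Gamma>. \<forall>x. vpol r \<beta> P s x \<le> vpol r \<beta> P \<sigma> x"
    by (simp add: optimal_policy_def)
next
  assume "\<forall>s\<in>policies \<Gamma>. \<forall>x. vpol r \<beta> P s x \<le> vpol r \<beta> P \<sigma> x"
  then have "vstar r \<Gamma> \<beta> P x = vpol r \<beta> P \<sigma> x" for x
    unfolding vstar_def using assms by (intro cSup_eq_maximum) auto
  then show "optimal_policy r \<Gamma> \<beta> P \<sigma>"
    by (simp add: optimal_policy_def)
qed

lemma not_optimal_imp_pos_advantage:
  assumes \<sigma>: "\<sigma> \<in> policies \<Gamma>" and "\<not> optimal_policy r \<Gamma> \<beta> P \<sigma>"
  obtains x a where "a \<in> \<Gamma> x" and "0 < advantage r \<beta> P (vpol r \<beta> P \<sigma>) x a"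
proof -
  obtain s where s: "s \<in> policies \<Gamma>" and "\<not> (\<forall>x. vpol r \<beta> P s x \<le> vpol r \<beta> P \<sigma> x)"
    using assms by (auto simp: optimal_policy_iff)
  then obtain x where "0 < advantage r \<beta> P (vpol r \<beta> P \<sigma>) x (s x)"
    using discounted_policy.vpol_le_if_advantage_nonpos[OF discounted_policy[OF s] vpol_bounded_borel[OF \<sigma>]]
    by (meson not_less)
  moreover have "s x \<in> \<Gamma> x"
    using s by (simp add: policies_def)
  ultimately show thesis
    by (rule that[rotated])
qed

lemma policy_modification:
  assumes \<sigma>: "\<sigma> \<in> policies \<Gamma>" and U: "U \<in> sets borel" and K: "closed K"
    and ne: "\<And>x. x \<in> U \<Longrightarrow> \<Gamma> x \<inter> K \<noteq> {}"
  obtains s where "s \<in> policies \<Gamma>" and "\<And>x. x \<in> U \<Longrightarrow> s x \<in> K" and "\<And>x. x \<notin> U \<Longrightarrow> s x = \<sigma> x"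
proof -
  define F where "F x = (if x \<in> U then \<Gamma> x \<inter> K else {\<sigma> x})" for x
  have F_subset: "F x \<subseteq> \<Gamma> x" for x
    using \<sigma> by (simp add: F_def policies_def)
  have compact_F: "compact (F x)" for x
    using K by (simp add: F_def compact_Int_closed compact_feasible)
  have F_ne: "F x \<noteq> {}" for x
    using ne by (simp add: F_def)
  have measurable_F: "measurable_correspondence borel F"
    unfolding F_def[abs_def]
  proof (intro measurable_correspondence_If measurable_correspondence_Int_closed
      measurable_correspondence_singleton upper_hemicontinuous_imp_measurable_correspondence)
    show "\<sigma> \<in> borel_measurable borel"
      using \<sigma> by (simp add: policies_def)
  qed (use U K upper_hemicontinuous_feasible in auto)
  obtain D :: "'x set" where "countable D" "closure D = UNIV"
    using separable by blast
  then obtain E where E: "countable E" "\<And>x. \<Gamma> x \<subseteq> closure E"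
    using lower_hemicontinuous_separable_range[OF lower_hemicontinuous_feasible compact_feasible]
    by blast
  have "F x \<subseteq> closure E" for x
    using F_subset E(2) by blast
  then obtain s where s: "s \<in> borel_measurable borel" "\<And>x. s x \<in> F x"
    using compact_valued_measurable_selection[OF measurable_F compact_F F_ne E(1)]
    by (metis UNIV_I space_borel)
  show thesis
  proof
    show "s \<in> policies \<Gamma>"
      using s F_subset by (auto simp: policies_def)
    show "s x \<in> K" if "x \<in> U" for x
      using s(2)[of x] that by (simp add: F_def)
    show "s x = \<sigma> x" if "x \<notin> U" for x
      using s(2)[of x] that by (simp add: F_def)
  qed
qed

lemma dominated_if_not_optimal:
  assumes \<sigma>: "\<sigma> \<in> policies \<Gamma>" and cont: "continuous_on UNIV \<sigma>"
    and irr: "open_set_irreducible (kpow P \<sigma>)" and not_optimal: "\<not> optimal_policy r \<Gamma> \<beta> P \<sigma>"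
  obtains s where "s \<in> policies \<Gamma>" and "\<And>x. vpol r \<beta> P \<sigma> x < vpol r \<beta> P s x"
proof -
  let ?A = "advantage r \<beta> P (vpol r \<beta> P \<sigma>)"
  obtain x0 a0 where a0: "a0 \<in> \<Gamma> x0" "0 < ?A x0 a0"
    using \<sigma> not_optimal by (rule not_optimal_imp_pos_advantage)
  have A_cont: "continuous_on (graphG \<Gamma>) (\<lambda>p. ?A (fst p) (snd p))"
    using vpol_bounded_borel[OF \<sigma>] continuous_on_vpol[OF \<sigma> cont]
    by (intro continuous_on_advantage) (simp_all add: bounded_borel_def)
  obtain U e where U: "open U" "x0 \<in> U" and ne: "\<And>x. x \<in> U \<Longrightarrow> \<Gamma> x \<inter> cball a0 e \<noteq> {}"
    and pos: "\<And>x a. x \<in> U \<Longrightarrow> a \<in> \<Gamma> x \<inter> cball a0 e \<Longrightarrow> 0 < ?A x a"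
    using lower_hemicontinuous_pos_neighbourhood[OF lower_hemicontinuous_feasible A_cont a0(1)] a0(2)
    unfolding fst_conv snd_conv by blast
  obtain s where s: "s \<in> policies \<Gamma>" and on: "\<And>x. x \<in> U \<Longrightarrow> s x \<in> cball a0 e"
    and off: "\<And>x. x \<notin> U \<Longrightarrow> s x = \<sigma> x"
    using policy_modification[OF \<sigma> borel_open[OF U(1)] closed_cball ne] by blast
  have "vpol r \<beta> P \<sigma> x < vpol r \<beta> P s x" for x
  proof -
    obtain n where "0 < kpow P \<sigma> n x U"
      using irr U unfolding open_set_irreducible_def reachable_def by blast
    moreover have "0 < ?A y (s y)" if "y \<in> U" for y
      using s on[OF that] by (intro pos[OF that]) (auto simp: policies_def)
    ultimately show ?thesis
      using off by (intro vpol_less_if_improvement_reached discounted_policy s \<sigma>)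
  qed
  with s show thesis
    by (rule that)
qed

lemma optimal_if_integral_maximal:
  assumes \<sigma>: "\<sigma> \<in> policies \<Gamma>" "continuous_on UNIV \<sigma>" "open_set_irreducible (kpow P \<sigma>)"
    and \<rho>: "prob_space \<rho>" "sets \<rho> = sets borel"
    and maximal: "\<And>s. s \<in> policies \<Gamma> \<Longrightarrow> (\<integral>y. vpol r \<beta> P s y \<partial>\<rho>) \<le> (\<integral>y. vpol r \<beta> P \<sigma> y \<partial>\<rho>)"
  shows "optimal_policy r \<Gamma> \<beta> P \<sigma>"
proof (rule ccontr)
  assume "\<not> optimal_policy r \<Gamma> \<beta> P \<sigma>"
  then obtain s where s: "s \<in> policies \<Gamma>" and less: "\<And>x. vpol r \<beta> P \<sigma> x < vpol r \<beta> P s x"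
    by (rule dominated_if_not_optimal[OF \<sigma>]) blast
  have "(\<integral>y. vpol r \<beta> P \<sigma> y \<partial>\<rho>) < (\<integral>y. vpol r \<beta> P s y \<partial>\<rho>)"
    by (rule integral_less_bounded_borel[OF \<rho> vpol_bounded_borel[OF \<sigma>(1)] vpol_bounded_borel[OF s] less])
  with maximal[OF s] show False
    by linarith
qed

end

lemma (in markov_decision_process) separable_if_irreducible:
  assumes "\<sigma> \<in> policies \<Gamma>" and "continuous_on UNIV \<sigma>" and irr: "open_set_irreducible (kpow P \<sigma>)"
  shows "separable_markov_decision_process r \<Gamma> \<beta> P"
proof
  interpret discounted_policy P \<sigma> r \<beta>
    using assms(1,2) by (rule discounted_policy_continuous)
  obtain D :: "'x set" where "countable D" "closure D = UNIV"
    by (rule countable_disjoint_open_imp_countable_dense[OF countable_disjoint_open_if_irreducible[OF irr]])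
  then show "\<exists>D :: 'x set. countable D \<and> closure D = UNIV"
    by blast
qed

theorem theorem4p2:
  fixes r :: "'x::metric_space \<Rightarrow> 'a::metric_space \<Rightarrow> real"
    and \<Gamma> :: "'x \<Rightarrow> 'a set" and \<beta> :: real and P :: "'x \<Rightarrow> 'a \<Rightarrow> 'x measure"
    and \<sigma> :: "'x \<Rightarrow> 'a"
  assumes mdp: "is_mdp r \<Gamma> \<beta> P"
    and pol: "\<sigma> \<in> policies \<Gamma>"
    and irr: "open_set_irreducible (kpow P \<sigma>)"
    and cont: "continuous_on UNIV \<sigma>"
  shows "((\<exists>x. \<forall>s\<in>policies \<Gamma>. vpol r \<beta> P s x \<le> vpol r \<beta> P \<sigma> x)
            \<longleftrightarrow> (\<exists>\<rho>. prob_space \<rho> \<and> sets \<rho> = sets (borel :: 'x measure) \<and>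
                  (\<forall>s\<in>policies \<Gamma>. (\<integral>y. vpol r \<beta> P s y \<partial>\<rho>) \<le> (\<integral>y. vpol r \<beta> P \<sigma> y \<partial>\<rho>))))
       \<and> ((\<exists>\<rho>. prob_space \<rho> \<and> sets \<rho> = sets (borel :: 'x measure) \<and>
                  (\<forall>s\<in>policies \<Gamma>. (\<integral>y. vpol r \<beta> P s y \<partial>\<rho>) \<le> (\<integral>y. vpol r \<beta> P \<sigma> y \<partial>\<rho>)))
            \<longleftrightarrow> optimal_policy r \<Gamma> \<beta> P \<sigma>)"
    (is "(?E1 \<longleftrightarrow> ?E2) \<and> (?E2 \<longleftrightarrow> ?E3)")
proof -
  interpret markov_decision_process r \<Gamma> \<beta> P
    by unfold_locales (rule mdp)
  interpret separable_markov_decision_process r \<Gamma> \<beta> P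
    using pol cont irr by (rule separable_if_irreducible)
  have E3_imp_E1: ?E1 if ?E3
    using that by (simp add: optimal_policy_iff[OF pol])
  have E1_imp_E2: ?E2 if ?E1
  proof -
    from that obtain x where "\<And>s. s \<in> policies \<Gamma> \<Longrightarrow> vpol r \<beta> P s x \<le> vpol r \<beta> P \<sigma> x"
      by blast
    with pol show ?thesis
      by (intro exI[of _ "return borel x"])
        (simp add: prob_space_return integral_return_bounded_borel vpol_bounded_borel)
  qed
  have E2_imp_E3: ?E3 if ?E2
    using that optimal_if_integral_maximal[OF pol cont irr] by blast
  show ?thesis
    using E3_imp_E1 E1_imp_E2 E2_imp_E3 by blast
qed

end
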